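(* The function $(\mathcal{A};R)\mapsto\mathcal{A}$ (acting on arrows by regarding an arrow $(\mathcal{A};R)\to(\mathcal{B};S)$ of $\mathrm{EQA}$ as the underlying arrow $\mathcal{A}\to\mathcal{B}$ of $\mathrm{QA}$) defines a surjective embedding $\mathsf{U}:\mathrm{EQA}\hookrightarrow\mathrm{QA}$, i.e. a faithful functor that is surjective on objects.
   Context: $\Bbbk$ is $\mathbb{R}$ or $\mathbb{C}$; algebras are unital associative $\Bbbk$-algebras. For a finite dimensional vector space $\mathbf{V}$, $\mathbf{V}^{\otimes}=\bigoplus_{n\ge 0}\mathbf{V}^{\otimes n}$ is its tensor algebra, and $I[\mathbf{X}]$ is the two-sided ideal of $\mathbf{V}^{\otimes}$ generated by a subset $\mathbf{X}$. The category $\mathrm{QA}$ of quadratic algebras: objects are pairs $\mathcal{A}=(\mathbf{A}_1,\mathbf{A})$ with $\mathbf{A}$ an algebra generated by a finite dimensional subspace $\mathbf{A}_1$, such that the kernel of the canonical epimorphism $\mathbf{A}_1^{\otimes}\twoheadrightarrow\mathbf{A}$ is $I[\mathbf{R}]$ for some subspace $\mathbf{R}\subset\mathbf{A}_1^{\otimes 2}$. Arrows $\alpha:(\mathbf{A}_1,\mathbf{A})\to(\mathbf{B}_1,\mathbf{B})$ are algebra homomorphisms $\mathbf{A}\to\mathbf{B}$ which restrict to a linear map $\alpha_1:\mathbf{A}_1\to\mathbf{B}_1$. The category $\mathrm{EQA}$ of equipped quantum spaces: objects are pairs $(\mathcal{A};R)$ with $\mathcal{A}=(\mathbf{A}_1,\mathbf{A})\in\mathrm{QA}$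 and $R:\mathbf{A}_1^{\otimes 2}\to\mathbf{A}_1^{\otimes 2}$ a linear map compatible with $\mathcal{A}$, meaning $\ker[\mathbf{A}_1^{\otimes}\twoheadrightarrow\mathbf{A}]=I[\operatorname{Im}R]$. Arrows $(\mathcal{A};R)\to(\mathcal{B};S)$ are arrows $\alpha:\mathcal{A}\to\mathcal{B}$ in $\mathrm{QA}$ such that $\alpha_1^{\otimes 2}\,R=S\,\alpha_1^{\otimes 2}$. *)

theory Defs
  imports
    Complex_Main
    "HOL-Library.FuncSet"
    "HOL-Library.Poly_Mapping"
    "HOL-Algebra.Algebraic_Closure_Type"
begin

section \<open>Categories and functors\<close>

record ('o, 'm) category =
  Ob :: "'o set"
  Hom :: "'o \<Rightarrow> 'o \<Rightarrow> 'm set"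
  Id :: "'o \<Rightarrow> 'm"
  Comp :: "'o \<Rightarrow> 'o \<Rightarrow> 'o \<Rightarrow> 'm \<Rightarrow> 'm \<Rightarrow> 'm"

text \<open>\<open>Comp C M N P g f\<close> is the composite of \<open>f : M \<rightarrow> N\<close> followed by \<open>g : N \<rightarrow> P\<close>.
  Hom-sets of different pairs of objects need not be disjoint.\<close>

definition is_category :: "('o, 'm) category \<Rightarrow> bool" where
  "is_category C \<longleftrightarrow>
     (\<forall>M\<in>Ob C. Id C M \<in> Hom C M M) \<and>
     (\<forall>M\<in>Ob C. \<forall>N\<in>Ob C. \<forall>P\<in>Ob C. \<forall>f\<in>Hom C M N. \<forall>g\<in>Hom C N P.
        Comp C M N P g f \<in> Hom C M P) \<and>
     (\<forall>M\<in>Ob C. \<forall>N\<in>Ob C. \<forall>f\<in>Hom C M N.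
        Comp C M M N f (Id C M) = f \<and> Comp C M N N (Id C N) f = f) \<and>
     (\<forall>L\<in>Ob C. \<forall>M\<in>Ob C. \<forall>N\<in>Ob C. \<forall>P\<in>Ob C.
        \<forall>f\<in>Hom C L M. \<forall>g\<in>Hom C M N. \<forall>h\<in>Hom C N P.
        Comp C L N P h (Comp C L M N g f) = Comp C L M P (Comp C M N P h g) f)"

record ('o, 'm, 'p, 'n) cat_functor =
  on_objects :: "'o \<Rightarrow> 'p"
  on_arrows :: "'o \<Rightarrow> 'o \<Rightarrow> 'm \<Rightarrow> 'n"

definition is_functor ::
  "('o, 'm) category \<Rightarrow> ('p, 'n) category \<Rightarrow> ('o, 'm, 'p, 'n) cat_functor \<Rightarrow> bool" where
  "is_functor C D F \<longleftrightarrow>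
     is_category C \<and> is_category D \<and>
     (\<forall>M\<in>Ob C. on_objects F M \<in> Ob D) \<and>
     (\<forall>M\<in>Ob C. \<forall>N\<in>Ob C. \<forall>f\<in>Hom C M N.
        on_arrows F M N f \<in> Hom D (on_objects F M) (on_objects F N)) \<and>
     (\<forall>M\<in>Ob C. on_arrows F M M (Id C M) = Id D (on_objects F M)) \<and>
     (\<forall>M\<in>Ob C. \<forall>N\<in>Ob C. \<forall>P\<in>Ob C. \<forall>f\<in>Hom C M N. \<forall>g\<in>Hom C N P.
        on_arrows F M P (Comp C M N P g f) =
        Comp D (on_objects F M) (on_objects F N) (on_objects F P)
          (on_arrows F N P g) (on_arrows F M N f))"

definition is_faithful ::
  "('o, 'm) category \<Rightarrow> ('o, 'm, 'p, 'n) cat_functor \<Rightarrow> bool" where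
  "is_faithful C F \<longleftrightarrow> (\<forall>M\<in>Ob C. \<forall>N\<in>Ob C. inj_on (on_arrows F M N) (Hom C M N))"

definition surjective_on_objects ::
  "('o, 'm) category \<Rightarrow> ('p, 'n) category \<Rightarrow> ('o, 'm, 'p, 'n) cat_functor \<Rightarrow> bool" where
  "surjective_on_objects C D F \<longleftrightarrow> on_objects F ` Ob C = Ob D"


section \<open>Algebras over a field\<close>

text \<open>The ground field is the type \<open>'k\<close>; vector spaces and algebras over it are
  records with an explicit carrier. The multiplicative part of a record that is used only
  as a vector space is irrelevant. The library locale \<open>algebra\<close> is restricted to commutative
  algebras and hence not applicable.\<close>

abbreviation scalars :: "'k::field ring" where
  "scalars \<equiv> ring_of_type_algebra"

definition is_algebra :: "('k::field, 'a) module \<Rightarrow> bool" where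
  "is_algebra A \<longleftrightarrow> module scalars A \<and> ring A \<and>
     (\<forall>c. \<forall>x\<in>carrier A. \<forall>y\<in>carrier A.
        (c \<odot>\<^bsub>A\<^esub> x) \<otimes>\<^bsub>A\<^esub> y = c \<odot>\<^bsub>A\<^esub> (x \<otimes>\<^bsub>A\<^esub> y) \<and>
        x \<otimes>\<^bsub>A\<^esub> (c \<odot>\<^bsub>A\<^esub> y) = c \<odot>\<^bsub>A\<^esub> (x \<otimes>\<^bsub>A\<^esub> y))"

abbreviation is_subspace :: "('k::field, 'a) module \<Rightarrow> 'a set \<Rightarrow> bool" where
  "is_subspace M H \<equiv> submodule H scalars M"

definition finite_dimensional_subspace :: "('k::field, 'a) module \<Rightarrow> 'a set \<Rightarrow> bool" where
  "finite_dimensional_subspace M H \<longleftrightarrow>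
     is_subspace M H \<and> (\<exists>S. finite S \<and> S \<subseteq> carrier M \<and> H = is_subspace M hull S)"

definition is_subalgebra :: "('k::field, 'a) module \<Rightarrow> 'a set \<Rightarrow> bool" where
  "is_subalgebra A B \<longleftrightarrow> is_subspace A B \<and> \<one>\<^bsub>A\<^esub> \<in> B \<and> (\<forall>x\<in>B. \<forall>y\<in>B. x \<otimes>\<^bsub>A\<^esub> y \<in> B)"

text \<open>Maps are extensional (\<open>undefined\<close> off the carrier), so that equality of maps is
  agreement on the carrier.\<close>

definition linear_maps ::
  "('k::field, 'a) module \<Rightarrow> ('k, 'b) module \<Rightarrow> ('a \<Rightarrow> 'b) set" where
  "linear_maps M N = {f \<in> carrier M \<rightarrow>\<^sub>E carrier N.
     (\<forall>x\<in>carrier M. \<forall>y\<in>carrier M. f (x \<oplus>\<^bsub>M\<^esub> y) = f x \<oplus>\<^bsub>N\<^esub> f y) \<and>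
     (\<forall>c. \<forall>x\<in>carrier M. f (c \<odot>\<^bsub>M\<^esub> x) = c \<odot>\<^bsub>N\<^esub> f x)}"

definition algebra_homs ::
  "('k::field, 'a) module \<Rightarrow> ('k, 'b) module \<Rightarrow> ('a \<Rightarrow> 'b) set" where
  "algebra_homs A B = ring_hom A B \<inter> linear_maps A B"


section \<open>The tensor algebra\<close>

text \<open>Words form a monoid under concatenation, so \<^typ>\<open>'a list \<Rightarrow>\<^sub>0 'k\<close> is the free
  associative algebra on \<open>'a\<close>, with the convolution product from the library.\<close>

instantiation list :: (type) monoid_add
begin
definition zero_list :: "'a list" where "zero_list = []"
definition plus_list :: "'a list \<Rightarrow> 'a list \<Rightarrow> 'a list" where "plus_list u v = u @ v"
instance by standard (simp_all add: zero_list_def plus_list_def)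
end

definition word_algebra ::
  "('k::field, 'a) module \<Rightarrow> ('k, 'a list \<Rightarrow>\<^sub>0 'k) module" where
  "word_algebra V =
     \<lparr>carrier = {p. Poly_Mapping.keys p \<subseteq> lists (carrier V)},
      monoid.mult = (*), one = 1, ring.zero = 0, add = (+),
      module.smult = (\<lambda>c. Poly_Mapping.map ((*) c))\<rparr>"

text \<open>The \<open>n\<close>-th tensor power of \<open>V\<close> is the free vector space on words
  \<open>x\<^sub>1 \<dots> x\<^sub>n\<close> over \<open>V\<close> modulo multilinearity in the letters. These relations are homogeneous
  in the word length, so dividing the free vector space on words of all lengths by all of them
  yields the direct sum of the tensor powers, the summands being the classes of
  combinations of words of a fixed length; the product is induced by concatenation.\<close>

definition multilinearity :: "('k::field, 'a) module \<Rightarrow> ('a list \<Rightarrow>\<^sub>0 'k) set" where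
  "multilinearity V =
     {Poly_Mapping.single (u @ [x \<oplus>\<^bsub>V\<^esub> y] @ v) 1
        - Poly_Mapping.single (u @ [x] @ v) 1 - Poly_Mapping.single (u @ [y] @ v) 1 | u v x y.
        u \<in> lists (carrier V) \<and> v \<in> lists (carrier V) \<and> x \<in> carrier V \<and> y \<in> carrier V} \<union>
     {Poly_Mapping.single (u @ [c \<odot>\<^bsub>V\<^esub> x] @ v) 1 - Poly_Mapping.single (u @ [x] @ v) c | u v c x.
        u \<in> lists (carrier V) \<and> v \<in> lists (carrier V) \<and> x \<in> carrier V}"

definition tensor_relations :: "('k::field, 'a) module \<Rightarrow> ('a list \<Rightarrow>\<^sub>0 'k) set" where
  "tensor_relations V = is_subspace (word_algebra V) hull (multilinearity V)"

abbreviation tensor_class ::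
  "('k::field, 'a) module \<Rightarrow> ('a list \<Rightarrow>\<^sub>0 'k) \<Rightarrow> ('a list \<Rightarrow>\<^sub>0 'k) set" where
  "tensor_class V p \<equiv> tensor_relations V +>\<^bsub>word_algebra V\<^esub> p"

definition tensor_algebra ::
  "('k::field, 'a) module \<Rightarrow> ('k, ('a list \<Rightarrow>\<^sub>0 'k) set) module" where
  "tensor_algebra V = ring.extend (word_algebra V Quot tensor_relations V)
     (module.fields (\<lambda>c T. \<Union>p\<in>T. tensor_class V (c \<odot>\<^bsub>word_algebra V\<^esub> p)))"

definition tensor_power ::
  "('k::field, 'a) module \<Rightarrow> nat \<Rightarrow> ('k, ('a list \<Rightarrow>\<^sub>0 'k) set) module" where
  "tensor_power V n = (tensor_algebra V)\<lparr>carrier :=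
     tensor_class V ` {p \<in> carrier (word_algebra V). \<forall>w\<in>Poly_Mapping.keys p. length w = n}\<rparr>"

text \<open>The map induced on tensors over \<open>V\<close> by a linear map \<open>f\<close> from \<open>V\<close> to \<open>W\<close>, sending
  the class of \<open>x\<^sub>1 \<dots> x\<^sub>n\<close> to the class of \<open>f x\<^sub>1 \<dots> f x\<^sub>n\<close>. Restricted to the \<open>n\<close>-th tensor
  power it is the \<open>n\<close>-th tensor power of \<open>f\<close>.\<close>

definition map_words :: "('a \<Rightarrow> 'b) \<Rightarrow> ('a list \<Rightarrow>\<^sub>0 'k) \<Rightarrow> ('b list \<Rightarrow>\<^sub>0 'k::field)" where
  "map_words f p =
     (\<Sum>w\<in>Poly_Mapping.keys p. Poly_Mapping.single (map f w) (Poly_Mapping.lookup p w))"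

definition tensor_map ::
  "('k::field, 'b) module \<Rightarrow> ('a \<Rightarrow> 'b) \<Rightarrow> ('a list \<Rightarrow>\<^sub>0 'k) set \<Rightarrow> ('b list \<Rightarrow>\<^sub>0 'k) set" where
  "tensor_map W f T = (\<Union>p\<in>T. tensor_class W (map_words f p))"

text \<open>The homomorphism from the tensor algebra of a subspace of an algebra \<open>A\<close> to \<open>A\<close>
  sending the class of \<open>x\<^sub>1 \<dots> x\<^sub>n\<close> to the product of the \<open>x\<^sub>i\<close> in \<open>A\<close>; its value does not
  depend on the representative.\<close>

definition evaluate_words :: "('k::field, 'a) module \<Rightarrow> ('a list \<Rightarrow>\<^sub>0 'k) \<Rightarrow> 'a" where
  "evaluate_words A p = (\<Oplus>\<^bsub>A\<^esub> w\<in>Poly_Mapping.keys p.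
     Poly_Mapping.lookup p w \<odot>\<^bsub>A\<^esub> foldr (\<otimes>\<^bsub>A\<^esub>) w \<one>\<^bsub>A\<^esub>)"

definition canonical_map :: "('k::field, 'a) module \<Rightarrow> ('a list \<Rightarrow>\<^sub>0 'k) set \<Rightarrow> 'a" where
  "canonical_map A T = the_elem (evaluate_words A ` T)"


section \<open>Quadratic algebras and equipped quantum spaces\<close>

type_synonym ('k, 'a) generated_algebra = "'a set \<times> ('k, 'a) module"

type_synonym ('k, 'a) tensor_endomap = "('a list \<Rightarrow>\<^sub>0 'k) set \<Rightarrow> ('a list \<Rightarrow>\<^sub>0 'k) set"

abbreviation generators :: "('k::field, 'a) generated_algebra \<Rightarrow> ('k, 'a) module" where
  "generators \<A> \<equiv> (snd \<A>)\<lparr>carrier := fst \<A>\<rparr>"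

definition canonical_kernel ::
  "('k::field, 'a) generated_algebra \<Rightarrow> ('a list \<Rightarrow>\<^sub>0 'k) set set" where
  "canonical_kernel \<A> =
     a_kernel (tensor_algebra (generators \<A>)) (snd \<A>) (canonical_map (snd \<A>))"

definition quadratic_algebras :: "('k::field, 'a) generated_algebra set" where
  "quadratic_algebras = {(A\<^sub>1, A).
     is_algebra A \<and> finite_dimensional_subspace A A\<^sub>1 \<and>
     is_subalgebra A hull A\<^sub>1 = carrier A \<and>
     (\<exists>R. is_subspace (tensor_power (generators (A\<^sub>1, A)) 2) R \<and>
        canonical_kernel (A\<^sub>1, A) = Idl\<^bsub>tensor_algebra (generators (A\<^sub>1, A))\<^esub> R)}"

definition quadratic_homs ::
  "('k::field, 'a) generated_algebra \<Rightarrow> ('k, 'a) generated_algebra \<Rightarrow> ('a \<Rightarrow> 'a) set" where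
  "quadratic_homs \<A> \<B> = {\<alpha> \<in> algebra_homs (snd \<A>) (snd \<B>). \<alpha> ` fst \<A> \<subseteq> fst \<B>}"

definition QA :: "(('k::field, 'a) generated_algebra, 'a \<Rightarrow> 'a) category" where
  "QA = \<lparr>Ob = quadratic_algebras, Hom = quadratic_homs,
     Id = (\<lambda>\<A>. \<lambda>x\<in>carrier (snd \<A>). x),
     Comp = (\<lambda>\<A> \<B> \<C> \<beta> \<alpha>. compose (carrier (snd \<A>)) \<beta> \<alpha>)\<rparr>"

definition compatible :: "('k::field, 'a) generated_algebra \<Rightarrow> ('k, 'a) tensor_endomap \<Rightarrow> bool" where
  "compatible \<A> R \<longleftrightarrow>
     canonical_kernel \<A> = Idl\<^bsub>tensor_algebra (generators \<A>)\<^esub>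
       (R ` carrier (tensor_power (generators \<A>) 2))"

definition EQA ::
  "(('k::field, 'a) generated_algebra \<times> ('k, 'a) tensor_endomap, 'a \<Rightarrow> 'a) category" where
  "EQA = \<lparr>
     Ob = {(\<A>, R). \<A> \<in> Ob QA \<and>
       R \<in> linear_maps (tensor_power (generators \<A>) 2) (tensor_power (generators \<A>) 2) \<and>
       compatible \<A> R},
     Hom = (\<lambda>(\<A>, R) (\<B>, S). {\<alpha> \<in> Hom QA \<A> \<B>.
       \<forall>T\<in>carrier (tensor_power (generators \<A>) 2).
         tensor_map (generators \<B>) \<alpha> (R T) = S (tensor_map (generators \<B>) \<alpha> T)}),
     Id = (\<lambda>(\<A>, R). Id QA \<A>),
     Comp = (\<lambda>(\<A>, R) (\<B>, S) (\<C>, T). Comp QA \<A> \<B> \<C>)\<rparr>"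

type_synonym ('k, 'a) forgetful_functor =
  "(('k, 'a) generated_algebra \<times> ('k, 'a) tensor_endomap, 'a \<Rightarrow> 'a,
    ('k, 'a) generated_algebra, 'a \<Rightarrow> 'a) cat_functor"

definition U_functor :: "('k::field, 'a) forgetful_functor" where
  "U_functor = \<lparr>on_objects = fst, on_arrows = (\<lambda>_ _ \<alpha>. \<alpha>)\<rparr>"

end

theory Submission
  imports Defs
begin

text \<open>An arrow of \<open>EQA\<close> is an arrow of \<open>QA\<close> with an additional property, and both identities
  and composites are those of \<open>QA\<close>. So the forgetful functor is the identity on arrows, and it is
  faithful and functorial as soon as the two categories are categories.

  The one point where \<open>EQA\<close> needs an argument is that the intertwining condition passes to
  identities and composites. Pasting the two squares of a composite uses that \<open>\<alpha> \<mapsto> \<alpha>\<^sub>1\<^sup>\<otimes>\<^sup>2\<close>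
  is functorial (\<open>tensor_map_identity\<close>, \<open>tensor_map_compose\<close>). A tensor is a coset of the multilinearity
  relations in the free vector space on words, and a linear map, applied to every letter, sends
  relations to relations (\<open>map_words_tensor_relations\<close>); hence the functoriality of tensor maps is
  inherited from that of applying a map to the letters of a word.

  Surjectivity on objects says that every quadratic algebra can be equipped. If its relations form
  the subspace \<open>R\<close> of the tensor square, any endomorphism of the tensor square with image \<open>R\<close> will
  do, and a projection onto \<open>R\<close> along a complement is one (\<open>subspace_is_image_of_endomorphism\<close>).

  All arguments work over an arbitrary field.\<close>

section \<open>The space of words\<close>

abbreviation scale_words :: "'k::field \<Rightarrow> ('a \<Rightarrow>\<^sub>0 'k) \<Rightarrow> ('a \<Rightarrow>\<^sub>0 'k)" where
  "scale_words c \<equiv> Poly_Mapping.map ((*) c)"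

lemma lookup_scale_words: "Poly_Mapping.lookup (scale_words c p) w = c * Poly_Mapping.lookup p w"
  by (simp add: Poly_Mapping.map.rep_eq when_def)

lemma scale_words_single: "scale_words c (Poly_Mapping.single w d) = Poly_Mapping.single w (c * d)"
  by (rule poly_mapping_eqI) (simp add: lookup_scale_words lookup_single when_def)

text \<open>The carrier of a word algebra is only a subspace of the type of all finitely supported
  functions on words, but that whole type is a vector space. Working there makes the library of
  type-based linear algebra available, in particular the existence of projections onto subspaces.\<close>

interpretation words: vector_space "scale_words :: 'k::field \<Rightarrow> ('a \<Rightarrow>\<^sub>0 'k) \<Rightarrow> ('a \<Rightarrow>\<^sub>0 'k)"
  by unfold_locales
    (auto intro!: poly_mapping_eqI simp: lookup_scale_words lookup_add algebra_simps)

interpretation words_pair: vector_space_pair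
  "scale_words :: 'k::field \<Rightarrow> ('a \<Rightarrow>\<^sub>0 'k) \<Rightarrow> ('a \<Rightarrow>\<^sub>0 'k)"
  "scale_words :: 'k::field \<Rightarrow> ('b \<Rightarrow>\<^sub>0 'k) \<Rightarrow> ('b \<Rightarrow>\<^sub>0 'k)"
  by unfold_locales

lemma scalars_simps [simp]:
  "carrier scalars = UNIV" "x \<otimes>\<^bsub>scalars\<^esub> y = x * y" "x \<oplus>\<^bsub>scalars\<^esub> y = x + y"
  "\<one>\<^bsub>scalars\<^esub> = 1" "\<zero>\<^bsub>scalars\<^esub> = 0"
  by (simp_all add: ring_of_type_algebra_def)

lemma word_algebra_simps [simp]:
  "p \<oplus>\<^bsub>word_algebra V\<^esub> q = p + q" "c \<odot>\<^bsub>word_algebra V\<^esub> p = scale_words c p"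
  "\<zero>\<^bsub>word_algebra V\<^esub> = 0"
  by (simp_all add: word_algebra_def)

lemma carrier_word_algebra:
  "carrier (word_algebra V) = {p. Poly_Mapping.keys p \<subseteq> lists (carrier V)}"
  by (simp add: word_algebra_def)

lemma keys_scale_words: "Poly_Mapping.keys (scale_words c p) \<subseteq> Poly_Mapping.keys p"
  by (auto simp: in_keys_iff lookup_scale_words)

lemma subspace_word_space: "words.subspace {p. Poly_Mapping.keys p \<subseteq> W}"
  by (auto simp: words.subspace_def dest!: keys_add[THEN subsetD] keys_scale_words[THEN subsetD])

lemma subspace_carrier_word_algebra: "words.subspace (carrier (word_algebra V))"
  unfolding carrier_word_algebra by (rule subspace_word_space)

lemma module_word_algebra: "module scalars (word_algebra V)"
proof -
  note subspace = subspace_carrier_word_algebra[of V]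
  show ?thesis
  proof (rule moduleI)
    show "abelian_group (word_algebra V)"
    proof (rule abelian_groupI)
      fix p assume "p \<in> carrier (word_algebra V)"
      then show "\<exists>q\<in>carrier (word_algebra V). q \<oplus>\<^bsub>word_algebra V\<^esub> p = \<zero>\<^bsub>word_algebra V\<^esub>"
        by (intro bexI[of _ "- p"]) (auto simp: words.subspace_neg[OF subspace])
    qed (auto simp: words.subspace_add[OF subspace] words.subspace_0[OF subspace] algebra_simps)
  qed (auto simp: words.subspace_scale[OF subspace] words.scale_left_distrib
      words.scale_right_distrib)
qed

text \<open>The bridge between submodules with an explicit carrier and type-based subspaces.\<close>

lemma submodule_word_algebra_iff:
  "is_subspace (word_algebra V) H \<longleftrightarrow> words.subspace H \<and> H \<subseteq> carrier (word_algebra V)"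
proof
  assume H: "is_subspace (word_algebra V) H"
  note facts = module.submoduleE[OF module_word_algebra H]
  have "0 \<in> H" using subgroup.one_closed[OF submodule.axioms(1)[OF H]] by simp
  then show "words.subspace H \<and> H \<subseteq> carrier (word_algebra V)"
    using facts(1,4,5) by (auto simp: words.subspace_def)
next
  assume H: "words.subspace H \<and> H \<subseteq> carrier (word_algebra V)"
  have neg: "\<ominus>\<^bsub>word_algebra V\<^esub> p = - p" if p: "p \<in> H" for p
  proof (rule abelian_group.minus_equality)
    show "abelian_group (word_algebra V)"
      using module_word_algebra[of V] by (simp add: module_def)
    show "p \<in> carrier (word_algebra V)" "- p \<in> carrier (word_algebra V)"
      using H p words.subspace_neg[of H p] by blast+
  qed simp
  show "is_subspace (word_algebra V) H"
  proof (rule module.submoduleI[OF module_word_algebra])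
    show "\<ominus>\<^bsub>word_algebra V\<^esub> p \<in> H" if "p \<in> H" for p
      using neg[OF that] H that words.subspace_neg[of H p] by simp
  qed (use H in \<open>simp_all add: words.subspace_def\<close>)
qed

section \<open>Arithmetic of tensor classes\<close>

lemma subspace_tensor_relations: "words.subspace (tensor_relations V)"
  unfolding tensor_relations_def hull_def
  by (intro words.subspace_Inter) (auto simp: submodule_word_algebra_iff)

lemma tensor_class_eq: "tensor_class V p = {k + p | k. k \<in> tensor_relations V}"
  by (auto simp: a_r_coset_defs)

lemma tensor_class_eq_iff: "tensor_class V p = tensor_class V q \<longleftrightarrow> p - q \<in> tensor_relations V"
proof
  assume "tensor_class V p = tensor_class V q"
  moreover have "p \<in> tensor_class V p"
    using words.subspace_0[OF subspace_tensor_relations[of V]] by (force simp: tensor_class_eq)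
  ultimately show "p - q \<in> tensor_relations V" by (auto simp: tensor_class_eq)
next
  assume d: "p - q \<in> tensor_relations V"
  note add = words.subspace_add[OF subspace_tensor_relations[of V]]
  note diff = words.subspace_diff[OF subspace_tensor_relations[of V]]
  show "tensor_class V p = tensor_class V q"
  proof (rule Set.set_eqI)
    fix x
    have "x - q \<in> tensor_relations V \<longleftrightarrow> x - p \<in> tensor_relations V"
      using add[OF _ d, of "x - p"] diff[OF _ d, of "x - q"] by auto
    moreover have "x \<in> tensor_class V r \<longleftrightarrow> x - r \<in> tensor_relations V" for r
      by (force simp: tensor_class_eq)
    ultimately show "x \<in> tensor_class V p \<longleftrightarrow> x \<in> tensor_class V q" by simp
  qed
qed

lemma mem_tensor_class_iff: "q \<in> tensor_class V p \<longleftrightarrow> tensor_class V q = tensor_class V p"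
  unfolding tensor_class_eq_iff by (force simp: tensor_class_eq)

lemma tensor_class_zero: "tensor_class V 0 = tensor_relations V"
  by (auto simp: tensor_class_eq)

lemma tensor_class_add:
  "tensor_class V p \<oplus>\<^bsub>tensor_power V n\<^esub> tensor_class V q = tensor_class V (p + q)"
proof -
  note subspace = subspace_tensor_relations[of V]
  have "tensor_class V p \<oplus>\<^bsub>tensor_power V n\<^esub> tensor_class V q
      = {x + y | x y. x \<in> tensor_class V p \<and> y \<in> tensor_class V q}"
    by (auto simp: tensor_power_def tensor_algebra_def ring.defs module.defs FactRing_def
        set_add_defs)
  also have "\<dots> = tensor_class V (p + q)"
  proof (intro Set.set_eqI iffI)
    fix z assume "z \<in> {x + y | x y. x \<in> tensor_class V p \<and> y \<in> tensor_class V q}"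
    then obtain k l where "k \<in> tensor_relations V" "l \<in> tensor_relations V"
      "z = (k + l) + (p + q)"
      by (auto simp: tensor_class_eq algebra_simps)
    then show "z \<in> tensor_class V (p + q)"
      using words.subspace_add[OF subspace] by (auto simp: tensor_class_eq)
  next
    fix z assume "z \<in> tensor_class V (p + q)"
    then obtain k where k: "k \<in> tensor_relations V" "z = k + (p + q)"
      by (auto simp: tensor_class_eq)
    have "z = (k + p) + (0 + q)" using k by (simp add: algebra_simps)
    moreover have "k + p \<in> tensor_class V p" using k by (auto simp: tensor_class_eq)
    moreover have "0 + q \<in> tensor_class V q"
      unfolding tensor_class_eq using words.subspace_0[OF subspace] by blast
    ultimately show "z \<in> {x + y | x y. x \<in> tensor_class V p \<and> y \<in> tensor_class V q}" by blast
  qed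
  finally show ?thesis .
qed

text \<open>Scalar multiples and tensor maps are defined as a union over all representatives. It collapses to the value
  at any one of them once the family is constant on the coset.\<close>

lemma union_over_tensor_class:
  assumes "\<And>q. q \<in> tensor_class V p \<Longrightarrow> F q = F p"
  shows "(\<Union>q\<in>tensor_class V p. F q) = F p"
proof -
  have "p \<in> tensor_class V p" by (simp add: mem_tensor_class_iff)
  then show ?thesis using assms by blast
qed

lemma tensor_class_smult:
  "c \<odot>\<^bsub>tensor_power V n\<^esub> tensor_class V p = tensor_class V (scale_words c p)"
proof -
  have "c \<odot>\<^bsub>tensor_power V n\<^esub> tensor_class V p
      = (\<Union>q\<in>tensor_class V p. tensor_class V (scale_words c q))"
    by (simp add: tensor_power_def tensor_algebra_def ring.defs module.defs)
  also have "\<dots> = tensor_class V (scale_words c p)"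
  proof (rule union_over_tensor_class)
    fix q assume "q \<in> tensor_class V p"
    then have "q - p \<in> tensor_relations V" by (simp only: mem_tensor_class_iff tensor_class_eq_iff)
    then show "tensor_class V (scale_words c q) = tensor_class V (scale_words c p)"
      unfolding tensor_class_eq_iff words.scale_right_diff_distrib[symmetric]
      by (rule words.subspace_scale[OF subspace_tensor_relations])
  qed
  finally show ?thesis .
qed

lemma tensor_power_zero: "\<zero>\<^bsub>tensor_power V n\<^esub> = tensor_class V 0"
  by (simp add: tensor_power_def tensor_algebra_def ring.defs module.defs FactRing_def
      tensor_class_zero)

lemma carrier_tensor_power:
  "carrier (tensor_power V n) = tensor_class V `
     {p. Poly_Mapping.keys p \<subseteq> {w \<in> lists (carrier V). length w = n}}"
  unfolding tensor_power_def by (auto simp: carrier_word_algebra intro!: image_cong)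

text \<open>The chosen representatives of tensors of degree \<open>n\<close> are homogeneous, and homogeneous
  elements of a fixed degree form a subspace.\<close>

lemma tensor_power_add_closed:
  assumes "S \<in> carrier (tensor_power V n)" "T \<in> carrier (tensor_power V n)"
  shows "S \<oplus>\<^bsub>tensor_power V n\<^esub> T \<in> carrier (tensor_power V n)"
  using assms words.subspace_add[OF subspace_word_space, of _ "{w \<in> lists (carrier V). length w = n}"]
  by (fastforce simp: carrier_tensor_power tensor_class_add)

lemma tensor_power_smult_closed:
  assumes "T \<in> carrier (tensor_power V n)"
  shows "c \<odot>\<^bsub>tensor_power V n\<^esub> T \<in> carrier (tensor_power V n)"
  using assms words.subspace_scale[OF subspace_word_space, of _ "{w \<in> lists (carrier V). length w = n}"]
  by (fastforce simp: carrier_tensor_power tensor_class_smult)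

section \<open>Subspaces of tensor powers as images\<close>

text \<open>The preimage of a space of tensors under the class map: the subspace onto which the space of
  words is going to be projected.\<close>

lemma subspace_lift:
  assumes R: "is_subspace (tensor_power V n) R"
  shows "words.subspace {p. tensor_class V p \<in> R}"
proof -
  have "\<zero>\<^bsub>tensor_power V n\<^esub> \<in> R"
    using subgroup.one_closed[OF submodule.axioms(1)[OF R]] by simp
  moreover have "S \<oplus>\<^bsub>tensor_power V n\<^esub> T \<in> R" if "S \<in> R" "T \<in> R" for S T
    using subgroup.m_closed[OF submodule.axioms(1)[OF R]] that by simp
  moreover have "c \<odot>\<^bsub>tensor_power V n\<^esub> T \<in> R" if "T \<in> R" for c T
    using submodule.smult_closed[OF R] that by simp
  ultimately show ?thesis
    by (auto simp: words.subspace_def tensor_power_zero tensor_class_add[where n = n, symmetric]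
        tensor_class_smult[where n = n, symmetric])
qed

text \<open>A projection of the space of words onto the preimage of \<open>R\<close> fixes the multilinearity relations,
  because they lie in that preimage. So it descends to tensors, where it takes values in \<open>R\<close> and
  fixes \<open>R\<close> pointwise. In this way no complement of \<open>R\<close> has to be found in the quotient itself.\<close>

lemma subspace_is_image_of_endomorphism:
  assumes R: "is_subspace (tensor_power V n) R"
  shows "\<exists>P\<in>linear_maps (tensor_power V n) (tensor_power V n).
    P ` carrier (tensor_power V n) = R"
proof -
  let ?L = "{p. tensor_class V p \<in> R}"
  let ?C = "carrier (tensor_power V n)"
  have "Vector_Spaces.linear scale_words scale_words (id :: ('a list \<Rightarrow>\<^sub>0 'b) \<Rightarrow> _)"
    by (rule words.linear_id)
  from words_pair.linear_exists_left_inverse_on[OF this subspace_lift[OF R]]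
  obtain g where g: "range g \<subseteq> ?L" "Vector_Spaces.linear scale_words scale_words g" "\<And>p. p \<in> ?L \<Longrightarrow> g p = p"
    by auto
  have RC: "R \<subseteq> ?C"
    using subgroup.subset[OF submodule.axioms(1)[OF R]] by simp
  define P where "P = (\<lambda>T\<in>?C. tensor_class V (g (SOME p. T = tensor_class V p)))"
  have P: "P (tensor_class V p) = tensor_class V (g p)" if "tensor_class V p \<in> ?C" for p
  proof -
    define q where "q = (SOME q. tensor_class V p = tensor_class V q)"
    have "tensor_class V p = tensor_class V q" unfolding q_def by (rule someI) simp
    then have d: "q - p \<in> tensor_relations V" by (metis tensor_class_eq_iff)
    \<comment> \<open>A relation represents the zero tensor, which belongs to \<open>R\<close>, so \<open>g\<close> fixes it.\<close>
    have "tensor_class V (q - p) = tensor_class V 0" using d by (simp add: tensor_class_eq_iff)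
    then have "q - p \<in> ?L"
      using words.subspace_0[OF subspace_lift[OF R]] by simp
    then have "g q - g p = q - p"
      using g(3) module_hom.diff[OF Vector_Spaces.linear.axioms(3)[OF g(2)], of q p] by auto
    then have "tensor_class V (g q) = tensor_class V (g p)" using d by (simp add: tensor_class_eq_iff)
    then show ?thesis using that by (simp add: P_def q_def)
  qed
  have rep: "\<exists>p. T = tensor_class V p" if "T \<in> ?C" for T
    using that by (auto simp: carrier_tensor_power)
  have image: "P T \<in> R" if T: "T \<in> ?C" for T
  proof -
    obtain p where "T = tensor_class V p" using rep[OF T] by blast
    moreover have "g p \<in> ?L" using g(1) by blast
    ultimately show ?thesis using T P by simp
  qed
  have fixed: "P T = T" if T: "T \<in> R" for T
  proof -
    obtain p where "T = tensor_class V p" using rep RC T by blast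
    then show ?thesis using T RC P g(3)[of p] by auto
  qed
  have "P \<in> linear_maps (tensor_power V n) (tensor_power V n)"
    unfolding linear_maps_def
  proof (intro CollectI conjI ballI allI)
    show "P \<in> ?C \<rightarrow>\<^sub>E ?C" using image RC by (auto simp: P_def)
  next
    fix S T assume S: "S \<in> ?C" and T: "T \<in> ?C"
    obtain p q where "S = tensor_class V p" "T = tensor_class V q" using rep S T by blast
    then show "P (S \<oplus>\<^bsub>tensor_power V n\<^esub> T) = P S \<oplus>\<^bsub>tensor_power V n\<^esub> P T"
      using S T tensor_power_add_closed[OF S T]
      by (simp add: P tensor_class_add words_pair.linear_add[OF g(2)])
  next
    fix c T assume T: "T \<in> ?C"
    obtain p where "T = tensor_class V p" using rep T by blast
    then show "P (c \<odot>\<^bsub>tensor_power V n\<^esub> T) = c \<odot>\<^bsub>tensor_power V n\<^esub> P T"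
      using T tensor_power_smult_closed[OF T]
      by (simp add: P tensor_class_smult words_pair.linear_scale[OF g(2)])
  qed
  moreover have "P ` ?C = R"
    using image fixed RC by force
  ultimately show ?thesis by blast
qed

section \<open>Functoriality of tensor maps\<close>

lemma map_words_eq_sum:
  assumes "finite S" "Poly_Mapping.keys p \<subseteq> S"
  shows "map_words f p = (\<Sum>w\<in>S. Poly_Mapping.single (map f w) (Poly_Mapping.lookup p w))"
  unfolding map_words_def
  by (rule sum.mono_neutral_left) (use assms in \<open>auto simp: in_keys_iff\<close>)

lemma map_words_add:
  fixes p q :: "'a list \<Rightarrow>\<^sub>0 'k::field"
  shows "map_words f (p + q) = map_words f p + map_words f q"
proof -
  let ?S = "Poly_Mapping.keys p \<union> Poly_Mapping.keys q"
  have "map_words f r = (\<Sum>w\<in>?S. Poly_Mapping.single (map f w) (Poly_Mapping.lookup r w))"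
    if "Poly_Mapping.keys r \<subseteq> ?S" for r :: "'a list \<Rightarrow>\<^sub>0 'k"
    using that by (intro map_words_eq_sum) auto
  then show ?thesis
    using keys_add[of p q] by (simp add: lookup_add single_add sum.distrib)
qed

lemma map_words_scale: "map_words f (scale_words c p) = scale_words c (map_words f p)"
proof -
  have "map_words f (scale_words c p) = (\<Sum>w\<in>Poly_Mapping.keys p.
      Poly_Mapping.single (map f w) (Poly_Mapping.lookup (scale_words c p) w))"
    by (intro map_words_eq_sum) (auto simp: keys_scale_words[THEN subsetD])
  then show ?thesis
    by (simp add: map_words_def lookup_scale_words words.scale_sum_right scale_words_single)
qed

lemma linear_map_words:
  "Vector_Spaces.linear scale_words scale_words (map_words f :: ('a list \<Rightarrow>\<^sub>0 'k::field) \<Rightarrow> ('b list \<Rightarrow>\<^sub>0 'k))"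
  by (simp add: Vector_Spaces.linear_iff words.vector_space_axioms map_words_add map_words_scale)

lemma map_words_single: "map_words f (Poly_Mapping.single w c) = Poly_Mapping.single (map f w) c"
  by (subst map_words_eq_sum[of "{w}"]) (auto split: if_splits)

text \<open>Only agreement on letters that occur is asked for, since the composite of two arrows is
  undefined outside the carrier.\<close>

lemma map_words_comp:
  assumes "\<And>w x. w \<in> Poly_Mapping.keys p \<Longrightarrow> x \<in> set w \<Longrightarrow> h x = g (f x)"
  shows "map_words h p = map_words g (map_words f p)"
proof -
  have "map_words g (map_words f p)
      = (\<Sum>w\<in>Poly_Mapping.keys p. Poly_Mapping.single (map g (map f w)) (Poly_Mapping.lookup p w))"
    unfolding map_words_def[of f]
    by (simp add: words_pair.linear_sum[OF linear_map_words] map_words_single)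
  also have "\<dots> = map_words h p"
    unfolding map_words_def using assms by (intro sum.cong) (auto intro!: arg_cong2[of _ _ _ _ Poly_Mapping.single])
  finally show ?thesis by simp
qed

lemma map_words_ident:
  assumes "\<And>w x. w \<in> Poly_Mapping.keys p \<Longrightarrow> x \<in> set w \<Longrightarrow> f x = x"
  shows "map_words f p = p"
proof -
  have "map f w = w" if "w \<in> Poly_Mapping.keys p" for w
    using assms that by (simp add: map_idI)
  then have "map_words f p
      = (\<Sum>w\<in>Poly_Mapping.keys p. Poly_Mapping.single w (Poly_Mapping.lookup p w))"
    unfolding map_words_def by (intro sum.cong) auto
  also have "\<dots> = p"
    by (rule poly_mapping_eqI) (auto simp: lookup_sum lookup_single when_def in_keys_iff)
  finally show ?thesis .
qed

lemma keys_map_words: "Poly_Mapping.keys (map_words f p) \<subseteq> map f ` Poly_Mapping.keys p"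
  unfolding map_words_def by (rule order_trans[OF keys_sum]) (auto split: if_splits)

text \<open>The words in the relations contain sums and multiples of letters, so this depends on
  \<open>V\<close> being closed under these operations.\<close>

lemma multilinearity_subset_word_algebra:
  assumes V: "module scalars V"
  shows "multilinearity V \<subseteq> carrier (word_algebra V)"
proof -
  interpret module scalars V by (rule V)
  note subspace = subspace_carrier_word_algebra[of V]
  have single: "Poly_Mapping.single w c \<in> carrier (word_algebra V)"
    if "\<forall>x\<in>set w. x \<in> carrier V" for w c
    using that by (auto simp: carrier_word_algebra split: if_splits)
  show ?thesis
    by (auto simp: multilinearity_def intro!: words.subspace_diff[OF subspace] single)
qed

lemma multilinearity_subset_tensor_relations: "multilinearity V \<subseteq> tensor_relations V"
  unfolding tensor_relations_def by (rule hull_subset)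

text \<open>The combinations of words sent to relations of \<open>W\<close> form a subspace, and it contains the generators of the
  relations of \<open>V\<close>: by linearity of \<open>f\<close>, applying \<open>f\<close> to the letters turns each defining relation
  into the relation of the same shape. The restriction of \<open>f\<close> appears because the maps to be used
  are defined on a whole algebra, and \<open>V\<close> is its space of generators.\<close>

lemma map_words_tensor_relations:
  assumes V: "module scalars V" and f: "restrict f (carrier V) \<in> linear_maps V W"
    and k: "k \<in> tensor_relations V"
  shows "map_words f k \<in> tensor_relations W"
proof -
  interpret V: module scalars V by (rule V)
  let ?H = "{p \<in> carrier (word_algebra V). map_words f p \<in> tensor_relations W}"
  have f_closed: "f x \<in> carrier W" if "x \<in> carrier V" for x
    using f that by (auto simp: linear_maps_def PiE_def Pi_def)
  have f_add: "f (x \<oplus>\<^bsub>V\<^esub> y) = f x \<oplus>\<^bsub>W\<^esub> f y" if "x \<in> carrier V" "y \<in> carrier V" for x y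
    using f that by (auto simp: linear_maps_def)
  have f_smult: "f (c \<odot>\<^bsub>V\<^esub> x) = c \<odot>\<^bsub>W\<^esub> f x" if "x \<in> carrier V" for c x
    using f that V.smult_closed by (auto simp: linear_maps_def)
  have "words.subspace ?H"
    using subspace_carrier_word_algebra[of V] subspace_tensor_relations[of W]
    by (auto simp: words.subspace_def map_words_add map_words_scale words_pair.linear_0[OF linear_map_words])
  then have "is_subspace (word_algebra V) ?H"
    by (auto simp: submodule_word_algebra_iff)
  moreover have "map_words f r \<in> multilinearity W" if "r \<in> multilinearity V" for r
    using that unfolding multilinearity_def[of V]
  proof (elim UnE CollectE exE conjE)
    fix u v x y
    assume r: "r = Poly_Mapping.single (u @ [x \<oplus>\<^bsub>V\<^esub> y] @ v) 1
        - Poly_Mapping.single (u @ [x] @ v) 1 - Poly_Mapping.single (u @ [y] @ v) 1"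
      and carrier: "u \<in> lists (carrier V)" "v \<in> lists (carrier V)" "x \<in> carrier V" "y \<in> carrier V"
    have "map f u \<in> lists (carrier W)" "map f v \<in> lists (carrier W)"
      using carrier f_closed by auto
    then show ?thesis
      unfolding multilinearity_def using carrier f_closed
      by (intro UnI1 CollectI exI[of _ "map f u"] exI[of _ "map f v"] exI[of _ "f x"] exI[of _ "f y"])
        (simp add: r words_pair.linear_diff[OF linear_map_words] map_words_single f_add)
  next
    fix u v c x
    assume r: "r = Poly_Mapping.single (u @ [c \<odot>\<^bsub>V\<^esub> x] @ v) 1
        - Poly_Mapping.single (u @ [x] @ v) c"
      and carrier: "u \<in> lists (carrier V)" "v \<in> lists (carrier V)" "x \<in> carrier V"
    have "map f u \<in> lists (carrier W)" "map f v \<in> lists (carrier W)"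
      using carrier f_closed by auto
    then show ?thesis
      unfolding multilinearity_def using carrier f_closed
      by (intro UnI2 CollectI exI[of _ "map f u"] exI[of _ "map f v"] exI[of _ c] exI[of _ "f x"])
        (simp add: r words_pair.linear_diff[OF linear_map_words] map_words_single f_smult)
  qed
  then have "multilinearity V \<subseteq> ?H"
    using multilinearity_subset_word_algebra[OF V] multilinearity_subset_tensor_relations by blast
  ultimately have "tensor_relations V \<subseteq> ?H"
    unfolding tensor_relations_def by (intro hull_minimal)
  then show ?thesis using k by blast
qed

lemma tensor_map_class:
  assumes "module scalars V" "restrict f (carrier V) \<in> linear_maps V W"
  shows "tensor_map W f (tensor_class V p) = tensor_class W (map_words f p)"
  unfolding tensor_map_def
proof (rule union_over_tensor_class)
  fix q assume "q \<in> tensor_class V p"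
  then have "q - p \<in> tensor_relations V" by (simp only: mem_tensor_class_iff tensor_class_eq_iff)
  then have "map_words f (q - p) \<in> tensor_relations W"
    by (rule map_words_tensor_relations[OF assms])
  then show "tensor_class W (map_words f q) = tensor_class W (map_words f p)"
    by (simp add: tensor_class_eq_iff words_pair.linear_diff[OF linear_map_words])
qed

lemma tensor_map_closed:
  assumes V: "module scalars V" and f: "restrict f (carrier V) \<in> linear_maps V W"
    and T: "T \<in> carrier (tensor_power V n)"
  shows "tensor_map W f T \<in> carrier (tensor_power W n)"
proof -
  have f_closed: "f x \<in> carrier W" if "x \<in> carrier V" for x
    using f that by (auto simp: linear_maps_def PiE_def Pi_def)
  obtain p where p: "Poly_Mapping.keys p \<subseteq> {w \<in> lists (carrier V). length w = n}"
    and T_eq: "T = tensor_class V p"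
    using T by (auto simp: carrier_tensor_power)
  have "Poly_Mapping.keys (map_words f p) \<subseteq> {w \<in> lists (carrier W). length w = n}"
    using keys_map_words[of f p] p f_closed by fastforce
  then show ?thesis
    unfolding T_eq tensor_map_class[OF V f] carrier_tensor_power by blast
qed

lemma tensor_map_compose:
  assumes V: "module scalars V" and W: "module scalars W"
    and f: "restrict f (carrier V) \<in> linear_maps V W"
    and g: "restrict g (carrier W) \<in> linear_maps W Z"
    and h: "restrict h (carrier V) \<in> linear_maps V Z"
    and hgf: "\<And>x. x \<in> carrier V \<Longrightarrow> h x = g (f x)"
    and T: "T \<in> carrier (tensor_power V n)"
  shows "tensor_map Z h T = tensor_map Z g (tensor_map W f T)"
proof -
  obtain p where p: "Poly_Mapping.keys p \<subseteq> {w \<in> lists (carrier V). length w = n}"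
    and T_eq: "T = tensor_class V p"
    using T by (auto simp: carrier_tensor_power)
  have "map_words h p = map_words g (map_words f p)"
    using p hgf by (intro map_words_comp) auto
  then show ?thesis
    unfolding T_eq tensor_map_class[OF V f] tensor_map_class[OF V h] tensor_map_class[OF W g] by simp
qed

lemma tensor_map_identity:
  assumes V: "module scalars V" and f: "restrict f (carrier V) \<in> linear_maps V V"
    and ident: "\<And>x. x \<in> carrier V \<Longrightarrow> f x = x"
    and T: "T \<in> carrier (tensor_power V n)"
  shows "tensor_map V f T = T"
proof -
  obtain p where p: "Poly_Mapping.keys p \<subseteq> {w \<in> lists (carrier V). length w = n}"
    and T_eq: "T = tensor_class V p"
    using T by (auto simp: carrier_tensor_power)
  have "map_words f p = p" using p ident by (intro map_words_ident) auto
  then show ?thesis unfolding T_eq tensor_map_class[OF V f] by simp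
qed

section \<open>The categories of quadratic algebras and of equipped quantum spaces\<close>

lemma quadratic_algebraD:
  assumes "\<A> \<in> quadratic_algebras"
  shows "is_algebra (snd \<A>)" "is_subspace (snd \<A>) (fst \<A>)" "fst \<A> \<subseteq> carrier (snd \<A>)"
    "module scalars (generators \<A>)"
proof -
  show alg: "is_algebra (snd \<A>)" and sub: "is_subspace (snd \<A>) (fst \<A>)"
    using assms by (auto simp: quadratic_algebras_def finite_dimensional_subspace_def)
  show "fst \<A> \<subseteq> carrier (snd \<A>)"
    using subgroup.subset[OF submodule.axioms(1)[OF sub]] by simp
  show "module scalars (generators \<A>)"
    using submodule.submodule_is_module[OF sub] alg by (simp add: is_algebra_def)
qed

lemma quadratic_hom_linear_on_generators:
  assumes \<A>: "\<A> \<in> quadratic_algebras" and \<alpha>: "\<alpha> \<in> quadratic_homs \<A> \<B>"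
  shows "restrict \<alpha> (carrier (generators \<A>)) \<in> linear_maps (generators \<A>) (generators \<B>)"
proof -
  interpret module scalars "generators \<A>" by (rule quadratic_algebraD(4)[OF \<A>])
  have "x \<oplus>\<^bsub>snd \<A>\<^esub> y \<in> fst \<A>" if "x \<in> fst \<A>" "y \<in> fst \<A>" for x y
    using a_closed[of x y] that by simp
  moreover have "c \<odot>\<^bsub>snd \<A>\<^esub> x \<in> fst \<A>" if "x \<in> fst \<A>" for c x
    using smult_closed[of c x] that by simp
  ultimately show ?thesis
    using \<alpha> quadratic_algebraD(3)[OF \<A>]
    unfolding quadratic_homs_def algebra_homs_def linear_maps_def
    by (auto simp: subset_iff)
qed

lemma identity_quadratic_hom:
  assumes "\<A> \<in> quadratic_algebras"
  shows "(\<lambda>x\<in>carrier (snd \<A>). x) \<in> quadratic_homs \<A> \<A>"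
proof -
  interpret M: module scalars "snd \<A>" using quadratic_algebraD(1)[OF assms] by (simp add: is_algebra_def)
  interpret A: ring "snd \<A>" using quadratic_algebraD(1)[OF assms] by (simp add: is_algebra_def)
  show ?thesis
    using quadratic_algebraD(3)[OF assms] M.smult_closed
    by (auto simp: quadratic_homs_def algebra_homs_def linear_maps_def ring_hom_def)
qed

lemma compose_quadratic_homs:
  assumes "\<A> \<in> quadratic_algebras" "\<alpha> \<in> quadratic_homs \<A> \<B>" "\<beta> \<in> quadratic_homs \<B> \<C>"
  shows "compose (carrier (snd \<A>)) \<beta> \<alpha> \<in> quadratic_homs \<A> \<C>"
proof -
  interpret M: module scalars "snd \<A>" using quadratic_algebraD(1)[OF assms(1)] by (simp add: is_algebra_def)
  interpret A: ring "snd \<A>" using quadratic_algebraD(1)[OF assms(1)] by (simp add: is_algebra_def)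
  have \<alpha>: "\<alpha> x \<in> carrier (snd \<B>)" if "x \<in> carrier (snd \<A>)" for x
    using assms(2) that by (auto simp: quadratic_homs_def algebra_homs_def ring_hom_def)
  show ?thesis
    using assms(2,3) quadratic_algebraD(3)[OF assms(1)] M.smult_closed \<alpha>
    by (auto simp: quadratic_homs_def algebra_homs_def linear_maps_def ring_hom_def compose_def
        Pi_def PiE_def image_subset_iff subset_iff)
qed

lemma compose_extensional_identity:
  assumes "\<alpha> \<in> quadratic_homs \<A> \<B>"
  shows "compose (carrier (snd \<A>)) \<alpha> (\<lambda>x\<in>carrier (snd \<A>). x) = \<alpha>"
    and "compose (carrier (snd \<A>)) (\<lambda>x\<in>carrier (snd \<B>). x) \<alpha> = \<alpha>"
  using assms
  by (auto simp: quadratic_homs_def algebra_homs_def linear_maps_def PiE_def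
      intro!: compose_Id Id_compose)

lemma quadratic_hom_funcset: "\<alpha> \<in> quadratic_homs \<A> \<B> \<Longrightarrow> \<alpha> \<in> carrier (snd \<A>) \<rightarrow> carrier (snd \<B>)"
  by (auto simp: quadratic_homs_def algebra_homs_def linear_maps_def)

lemma is_category_QA: "is_category (QA :: (('k::field, 'a) generated_algebra, 'a \<Rightarrow> 'a) category)"
  unfolding is_category_def
  by (auto simp: QA_def identity_quadratic_hom compose_quadratic_homs compose_extensional_identity
      compose_assoc[OF quadratic_hom_funcset])

lemma EQA_simps:
  "M \<in> Ob EQA \<longleftrightarrow> fst M \<in> quadratic_algebras \<and>
     snd M \<in> linear_maps (tensor_power (generators (fst M)) 2) (tensor_power (generators (fst M)) 2) \<and>
     compatible (fst M) (snd M)"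
  "\<alpha> \<in> Hom EQA M N \<longleftrightarrow> \<alpha> \<in> quadratic_homs (fst M) (fst N) \<and>
     (\<forall>T\<in>carrier (tensor_power (generators (fst M)) 2).
       tensor_map (generators (fst N)) \<alpha> (snd M T) = snd N (tensor_map (generators (fst N)) \<alpha> T))"
  "Id EQA M = (\<lambda>x\<in>carrier (snd (fst M)). x)"
  "Comp EQA M N L \<beta> \<alpha> = compose (carrier (snd (fst M))) \<beta> \<alpha>"
  by (simp_all add: EQA_def QA_def case_prod_beta)

lemma identity_EQA:
  assumes M: "M \<in> Ob EQA"
  shows "Id EQA M \<in> Hom EQA M M"
proof -
  let ?V = "generators (fst M)"
  have \<A>: "fst M \<in> quadratic_algebras"
    and R: "snd M \<in> linear_maps (tensor_power ?V 2) (tensor_power ?V 2)"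
    using M by (auto simp: EQA_simps)
  have "tensor_map ?V (\<lambda>x\<in>carrier (snd (fst M)). x) T = T"
    if "T \<in> carrier (tensor_power ?V 2)" for T
    using quadratic_hom_linear_on_generators[OF \<A> identity_quadratic_hom[OF \<A>]]
      quadratic_algebraD(3)[OF \<A>] that
    by (intro tensor_map_identity[OF quadratic_algebraD(4)[OF \<A>]]) auto
  moreover have "snd M T \<in> carrier (tensor_power ?V 2)" if "T \<in> carrier (tensor_power ?V 2)" for T
    using R that by (auto simp: linear_maps_def)
  ultimately show ?thesis
    using identity_quadratic_hom[OF \<A>] by (simp add: EQA_simps)
qed

text \<open>The two squares for \<open>\<alpha>\<close> and \<open>\<beta>\<close> are pasted together. The square for \<open>\<beta>\<close> is applied to
  \<open>\<alpha>\<^sub>1\<^sup>\<otimes>\<^sup>2 T\<close>, which is where closure of tensor maps enters.\<close>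

lemma compose_EQA:
  assumes obs: "M \<in> Ob EQA" "N \<in> Ob EQA"
    and \<alpha>: "\<alpha> \<in> Hom EQA M N" and \<beta>: "\<beta> \<in> Hom EQA N L"
  shows "Comp EQA M N L \<beta> \<alpha> \<in> Hom EQA M L"
proof -
  let ?V = "generators (fst M)" and ?W = "generators (fst N)" and ?Z = "generators (fst L)"
  let ?\<gamma> = "compose (carrier (snd (fst M))) \<beta> \<alpha>"
  have \<A>: "fst M \<in> quadratic_algebras" and \<B>: "fst N \<in> quadratic_algebras"
    using obs by (auto simp: EQA_simps)
  have R: "snd M T \<in> carrier (tensor_power ?V 2)" if "T \<in> carrier (tensor_power ?V 2)" for T
    using obs that by (auto simp: EQA_simps linear_maps_def)
  have hom: "\<alpha> \<in> quadratic_homs (fst M) (fst N)" "\<beta> \<in> quadratic_homs (fst N) (fst L)"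
    using \<alpha> \<beta> by (auto simp: EQA_simps)
  note \<gamma> = compose_quadratic_homs[OF \<A> hom]
  note linear_\<alpha> = quadratic_hom_linear_on_generators[OF \<A> hom(1)]
  have comp: "tensor_map ?Z ?\<gamma> T = tensor_map ?Z \<beta> (tensor_map ?W \<alpha> T)"
    if "T \<in> carrier (tensor_power ?V 2)" for T
    using quadratic_algebraD(3)[OF \<A>]
    by (intro tensor_map_compose[OF quadratic_algebraD(4)[OF \<A>] quadratic_algebraD(4)[OF \<B>]
          linear_\<alpha> quadratic_hom_linear_on_generators[OF \<B> hom(2)]
          quadratic_hom_linear_on_generators[OF \<A> \<gamma>] _ that])
      (auto simp: compose_def)
  have "tensor_map ?Z ?\<gamma> (snd M T) = snd L (tensor_map ?Z ?\<gamma> T)"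
    if T: "T \<in> carrier (tensor_power ?V 2)" for T
    using \<alpha> \<beta> T comp[OF T] comp[OF R[OF T]]
      tensor_map_closed[OF quadratic_algebraD(4)[OF \<A>] linear_\<alpha> T]
    by (simp add: EQA_simps)
  then show ?thesis using \<gamma> by (simp add: EQA_simps)
qed

lemma is_category_EQA:
  "is_category (EQA :: (('k::field, 'a) generated_algebra \<times> ('k, 'a) tensor_endomap,
     'a \<Rightarrow> 'a) category)"
  unfolding is_category_def
proof (intro conjI ballI)
  fix M N :: "('k, 'a) generated_algebra \<times> ('k, 'a) tensor_endomap" and \<alpha>
  assume "\<alpha> \<in> Hom EQA M N"
  then have "\<alpha> \<in> quadratic_homs (fst M) (fst N)" by (simp add: EQA_simps)
  note identity_laws = compose_extensional_identity[OF this]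
  show "Comp EQA M M N \<alpha> (Id EQA M) = \<alpha>" "Comp EQA M N N (Id EQA N) \<alpha> = \<alpha>"
    by (simp_all add: EQA_simps(3,4) identity_laws)
next
  fix L M N P :: "('k, 'a) generated_algebra \<times> ('k, 'a) tensor_endomap" and \<alpha> \<beta> \<gamma>
  assume "\<alpha> \<in> Hom EQA L M"
  then have "\<alpha> \<in> carrier (snd (fst L)) \<rightarrow> carrier (snd (fst M))"
    by (auto simp: EQA_simps dest: quadratic_hom_funcset)
  then show "Comp EQA L N P \<gamma> (Comp EQA L M N \<beta> \<alpha>) = Comp EQA L M P (Comp EQA M N P \<gamma> \<beta>) \<alpha>"
    by (simp add: EQA_simps(4) compose_assoc)
qed (simp_all add: identity_EQA compose_EQA)

section \<open>The forgetful functor\<close>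

lemma is_functor_U: "is_functor EQA QA (U_functor :: ('k::field, 'a) forgetful_functor)"
  unfolding is_functor_def using is_category_QA is_category_EQA
  by (auto simp: U_functor_def EQA_def QA_def)

lemma is_faithful_U: "is_faithful EQA (U_functor :: ('k::field, 'a) forgetful_functor)"
  by (simp add: is_faithful_def U_functor_def)

text \<open>Compatibility sees the endomorphism only through its image, so any endomorphism whose image
  is the given space of relations equips the algebra.\<close>

lemma surjective_on_objects_U:
  "surjective_on_objects EQA QA (U_functor :: ('k::field, 'a) forgetful_functor)"
  unfolding surjective_on_objects_def
proof
  show "on_objects U_functor ` Ob EQA \<subseteq> Ob (QA :: (('k, 'a) generated_algebra, _) category)"
    by (auto simp: U_functor_def EQA_def)
  show "Ob (QA :: (('k, 'a) generated_algebra, _) category) \<subseteq> on_objects U_functor ` Ob EQA"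
  proof
    fix \<A> :: "('k, 'a) generated_algebra" assume \<A>: "\<A> \<in> Ob QA"
    then obtain R where R: "is_subspace (tensor_power (generators \<A>) 2) R"
      and kernel: "canonical_kernel \<A> = Idl\<^bsub>tensor_algebra (generators \<A>)\<^esub> R"
      by (auto simp: QA_def quadratic_algebras_def)
    obtain P where
      "P \<in> linear_maps (tensor_power (generators \<A>) 2) (tensor_power (generators \<A>) 2)"
      "P ` carrier (tensor_power (generators \<A>) 2) = R"
      using subspace_is_image_of_endomorphism[OF R] by blast
    then have "(\<A>, P) \<in> Ob EQA"
      using \<A> kernel by (simp add: EQA_def compatible_def)
    then show "\<A> \<in> on_objects U_functor ` Ob EQA"
      by (force simp: U_functor_def)
  qed
qed

theorem proposition2:
  shows "(is_functor EQA QA (U_functor :: (real, 'a) forgetful_functor) \<and>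
      is_faithful EQA (U_functor :: (real, 'a) forgetful_functor) \<and>
      surjective_on_objects EQA QA (U_functor :: (real, 'a) forgetful_functor)) \<and>
    (is_functor EQA QA (U_functor :: (complex, 'b) forgetful_functor) \<and>
      is_faithful EQA (U_functor :: (complex, 'b) forgetful_functor) \<and>
      surjective_on_objects EQA QA (U_functor :: (complex, 'b) forgetful_functor))"
  by (simp add: is_functor_U is_faithful_U surjective_on_objects_U)

end
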